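(* For every $n\in\mathbb{N}$, the polynomial $e_n$ of degree $n$ satisfying $e_n'(x)+e_n(x)=x^n$ is $$e_n(x)=x^n+\sum_{l=0}^{n-1}(-1)^{l+n}\,\frac{n!}{l!}\,x^l .$$
   Context: $\mathbb{N}=\{0,1,2,\dots\}$; an empty sum is $0$. The polynomials $e_n$ are those for which $\int x^n e^x\,dx=e_n(x)e^x+\text{constant}$, equivalently $e_n'+e_n=x^n$. *)

theory Defs
  imports Complex_Main "HOL-Computational_Algebra.Polynomial"
begin

definition is_e_poly :: "nat \<Rightarrow> real poly \<Rightarrow> bool" where
  "is_e_poly n p \<longleftrightarrow> degree p = n \<and> (\<forall>x. poly (pderiv p) x + poly p x = x ^ n)"

definition e_poly :: "nat \<Rightarrow> real poly" where
  "e_poly n = (THE p. is_e_poly n p)"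

end

theory Submission
  imports Defs
begin

text \<open>The map \<open>p\<close> to \<open>pderiv p + p\<close> is linear with trivial kernel,
  since differentiation lowers the degree of a nonconstant polynomial
  (\<open>pderiv_add_self_eq_0_iff\<close>); hence a solution is unique. For existence, comparing
  coefficients in the equation gives c_n = 1 and (l+1) c_(l+1) = -c_l for l < n, which the closed
  form satisfies (\<open>is_e_poly_explicit\<close>).\<close>

lemma pderiv_add_self_eq_0_iff:
  fixes p :: "'a :: {idom, semiring_char_0} poly"
  shows "pderiv p + p = 0 \<longleftrightarrow> p = 0"
proof
  assume "pderiv p + p = 0"
  then have "pderiv p = - p"
    by (simp add: eq_neg_iff_add_eq_0)
  then have "degree p - 1 = degree p"
    by (metis degree_minus degree_pderiv)
  \<comment> \<open>Subtraction on \<open>nat\<close> is truncated, so the equation forces degree 0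
    rather than a contradiction.\<close>
  then have "pderiv p = 0"
    by (simp add: pderiv_eq_0_iff)
  with \<open>pderiv p = - p\<close> show "p = 0"
    by simp
qed simp

text \<open>Real polynomials agreeing at every point are equal, so the pointwise equation can be
  treated coefficientwise.\<close>

lemma is_e_poly_iff:
  "is_e_poly n p \<longleftrightarrow> degree p = n \<and> pderiv p + p = monom 1 n"
  unfolding is_e_poly_def poly_eq_poly_eq_iff[symmetric] fun_eq_iff
  by (simp add: poly_monom)

lemma is_e_poly_unique:
  assumes "is_e_poly n p" "is_e_poly n q"
  shows "p = q"
proof -
  have "pderiv (p - q) + (p - q) = 0"
    using assms by (simp add: is_e_poly_iff pderiv_diff algebra_simps)
  then show ?thesis
    by (simp add: pderiv_add_self_eq_0_iff)
qed

text \<open>Including l = n absorbs the leading term: the coefficient there is 1.\<close>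

definition e_poly_explicit :: "nat \<Rightarrow> real poly" where
  "e_poly_explicit n = (\<Sum>l\<le>n. monom ((-1) ^ (l + n) * (fact n / fact l)) l)"

lemma coeff_e_poly_explicit:
  "coeff (e_poly_explicit n) l = (if l \<le> n then (-1) ^ (l + n) * (fact n / fact l) else 0)"
  by (simp add: e_poly_explicit_def coeff_sum)

lemma poly_e_poly_explicit:
  "poly (e_poly_explicit n) x = x ^ n + (\<Sum>l<n. (-1) ^ (l + n) * (fact n / fact l) * x ^ l)"
  by (simp add: e_poly_explicit_def poly_sum poly_monom lessThan_Suc_atMost[symmetric])

lemma is_e_poly_explicit: "is_e_poly n (e_poly_explicit n)"
  unfolding is_e_poly_iff
proof
  show "degree (e_poly_explicit n) = n"
    by (intro antisym degree_le le_degree) (simp_all add: coeff_e_poly_explicit)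
  show "pderiv (e_poly_explicit n) + e_poly_explicit n = monom 1 n"
  proof (rule poly_eqI)
    fix l
    \<comment> \<open>The recursion for the coefficient formula holds at every l, even beyond the
      cutoff at n.\<close>
    have "real (Suc l) * (fact n / fact (Suc l)) = fact n / fact l"
      by (simp del: of_nat_Suc)
    then have "real (Suc l) * ((-1) ^ (Suc l + n) * (fact n / fact (Suc l)))
        = - ((-1) ^ (l + n) * (fact n / fact l))"
      by (metis mult.left_commute mult_minus_left mult_1 power_Suc add_Suc)
    \<comment> \<open>For l < n the two contributions cancel; at l = n the derivative contributes 0,
      leaving 1; for l > n both vanish.\<close>
    then show "coeff (pderiv (e_poly_explicit n) + e_poly_explicit n) l = coeff (monom 1 n) l"
      by (auto simp: coeff_pderiv coeff_e_poly_explicit not_le less_Suc_eq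
          simp del: of_nat_Suc fact_Suc power_Suc add_Suc)
  qed
qed

theorem mainTheorem3:
  fixes n :: nat
  shows "(\<exists>!p. is_e_poly n p) \<and>
    (\<forall>x::real. poly (e_poly n) x = x ^ n + (\<Sum>l<n. (-1) ^ (l + n) * (fact n / fact l) * x ^ l))"
proof -
  have "e_poly n = e_poly_explicit n"
    unfolding e_poly_def
    by (rule the_equality) (auto intro: is_e_poly_explicit is_e_poly_unique)
  then show ?thesis
    using is_e_poly_explicit is_e_poly_unique poly_e_poly_explicit by metis
qed

end
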